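(* Let $C$ be a commutative ring with unity, let $n\geq 2$, and let $\mathcal{T}_n(C)$ be the $C$-algebra of $n\times n$ upper triangular matrices over $C$. Then every Jordan derivation $D:\mathcal{T}_n(C)\to\mathcal{T}_n(C)$ is an inner derivation.
   Context: Let $T$ be an algebra over a commutative ring $C$ with unity. A map $D:T\to T$ is a Jordan derivation if it is $C$-linear and $D(a^2)=D(a)a+aD(a)$ for all $a\in T$. A $C$-linear map $D:T\to T$ is a derivation if $D(ab)=D(a)b+aD(b)$ for all $a,b\in T$. A derivation $D:T\to T$ is an inner derivation if there exists $a_0\in T$ such that $D(a)=a_0a-aa_0$ for all $a\in T$. The ring $C$ is not assumed to be $2$-torsion free. *)

theory Defs
  imports "Jordan_Normal_Form.Matrix"
begin

text \<open>
  Matrices of every size share the type \<open>'c mat\<close>, so an algebra of matrices is given by its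
  carrier set \<open>T\<close>, and the values of a map \<open>D\<close> outside \<open>T\<close> are irrelevant.
  The scalars range over the whole type \<open>'c\<close>. Its sort
  \<open>{comm_ring, comm_monoid_mult}\<close> is that of commutative rings with unity; in contrast to
  \<open>comm_ring_1\<close> it does not impose \<open>0 \<noteq> 1\<close>.
\<close>

definition upper_triangular_mats :: "nat \<Rightarrow> 'c :: {comm_ring, comm_monoid_mult} mat set" where
  "upper_triangular_mats n = {A \<in> carrier_mat n n. upper_triangular A}"

definition mat_linear_on ::
    "'c :: {comm_ring, comm_monoid_mult} mat set \<Rightarrow> ('c mat \<Rightarrow> 'c mat) \<Rightarrow> bool" where
  "mat_linear_on T D \<longleftrightarrow>
     (\<forall>a\<in>T. D a \<in> T) \<and>
     (\<forall>a\<in>T. \<forall>b\<in>T. D (a + b) = D a + D b) \<and>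
     (\<forall>c. \<forall>a\<in>T. D (c \<cdot>\<^sub>m a) = c \<cdot>\<^sub>m D a)"

definition jordan_derivation_on ::
    "'c :: {comm_ring, comm_monoid_mult} mat set \<Rightarrow> ('c mat \<Rightarrow> 'c mat) \<Rightarrow> bool" where
  "jordan_derivation_on T D \<longleftrightarrow>
     mat_linear_on T D \<and> (\<forall>a\<in>T. D (a * a) = D a * a + a * D a)"

definition derivation_on ::
    "'c :: {comm_ring, comm_monoid_mult} mat set \<Rightarrow> ('c mat \<Rightarrow> 'c mat) \<Rightarrow> bool" where
  "derivation_on T D \<longleftrightarrow>
     mat_linear_on T D \<and> (\<forall>a\<in>T. \<forall>b\<in>T. D (a * b) = D a * b + a * D b)"

definition inner_derivation_on ::
    "'c :: {comm_ring, comm_monoid_mult} mat set \<Rightarrow> ('c mat \<Rightarrow> 'c mat) \<Rightarrow> bool" where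
  "inner_derivation_on T D \<longleftrightarrow>
     derivation_on T D \<and> (\<exists>a\<^sub>0\<in>T. \<forall>a\<in>T. D a = a\<^sub>0 * a - a * a\<^sub>0)"

end

theory Submission
  imports Defs
begin

text \<open>
  Polarising the Jordan identity gives \<open>D (a * b + b * a)\<close>, which avoids any division by 2.
  Evaluated at matrix units \<open>E i j\<close>, it determines every entry of \<open>D (E i j)\<close> except the
  \<open>(i, j)\<close> one from the strictly upper triangular matrix with entries \<open>D (E q q) $$ (p, q)\<close>.
  For the remaining entries, \<open>E 0 j = E 0 i * E i j + E i j * E 0 i\<close> with \<open>0 < i < j\<close>
  shows that \<open>c i j = D (E i j) $$ (i, j)\<close> satisfies \<open>c i j = c 0 j - c 0 i\<close>, so on these
  entries \<open>D\<close> is the commutator with the diagonal matrix with entries \<open>- c 0 p\<close>.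
\<close>

section \<open>Matrix units and entries of products with them\<close>

definition matrix_unit :: "nat \<Rightarrow> nat \<Rightarrow> nat \<Rightarrow> 'c :: {comm_ring, comm_monoid_mult} mat" where
  "matrix_unit n i j = mat n n (\<lambda>(p, q). if p = i \<and> q = j then 1 else 0)"

lemma matrix_unit_carrier [simp]: "matrix_unit n i j \<in> carrier_mat n n"
  by (simp add: matrix_unit_def)

lemma matrix_unit_index [simp]:
  "p < n \<Longrightarrow> q < n \<Longrightarrow> matrix_unit n i j $$ (p, q) = (if p = i \<and> q = j then 1 else 0)"
  by (simp add: matrix_unit_def)

lemma carrier_mat_eqI:
  assumes "A \<in> carrier_mat n m" "B \<in> carrier_mat n m"
    and "\<And>p q. p < n \<Longrightarrow> q < m \<Longrightarrow> A $$ (p, q) = B $$ (p, q)"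
  shows "A = B"
  using assms by (intro eq_matI) auto

lemma mult_mat_index:
  assumes "A \<in> carrier_mat n n" "B \<in> carrier_mat n n" "p < n" "q < n"
  shows "(A * B) $$ (p, q) = (\<Sum>k<n. A $$ (p, k) * B $$ (k, q))"
  using assms by (auto simp: scalar_prod_def lessThan_atLeast0 intro!: sum.cong)

lemma mult_matrix_unit_index:
  assumes "A \<in> carrier_mat n n" "i < n" "p < n" "q < n"
  shows "(A * matrix_unit n i j) $$ (p, q) = (if q = j then A $$ (p, i) else 0)"
proof -
  have "(A * matrix_unit n i j) $$ (p, q) = (\<Sum>k<n. if k = i then (if q = j then A $$ (p, i) else 0) else 0)"
    unfolding mult_mat_index[OF assms(1) matrix_unit_carrier assms(3,4)]
    using assms by (intro sum.cong) auto
  then show ?thesis using assms by simp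
qed

lemma matrix_unit_mult_index:
  assumes "A \<in> carrier_mat n n" "j < n" "p < n" "q < n"
  shows "(matrix_unit n i j * A) $$ (p, q) = (if p = i then A $$ (j, q) else 0)"
proof -
  have "(matrix_unit n i j * A) $$ (p, q) = (\<Sum>k<n. if k = j then (if p = i then A $$ (j, q) else 0) else 0)"
    unfolding mult_mat_index[OF matrix_unit_carrier assms(1) assms(3,4)]
    using assms by (intro sum.cong) auto
  then show ?thesis using assms by simp
qed

section \<open>The algebra of upper triangular matrices, its commutators and its linear maps\<close>

lemma upper_triangular_mats_iff:
  "A \<in> upper_triangular_mats n \<longleftrightarrow>
     A \<in> carrier_mat n n \<and> (\<forall>p q. q < p \<longrightarrow> p < n \<longrightarrow> A $$ (p, q) = 0)"
  by (auto simp: upper_triangular_mats_def upper_triangular_def)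

lemma matrix_unit_upper_triangular:
  "i \<le> j \<Longrightarrow> matrix_unit n i j \<in> upper_triangular_mats n"
  by (auto simp: upper_triangular_mats_iff)

lemma upper_triangular_mats_carrier: "A \<in> upper_triangular_mats n \<Longrightarrow> A \<in> carrier_mat n n"
  by (simp add: upper_triangular_mats_def)

lemma upper_triangular_mats_add:
  "A \<in> upper_triangular_mats n \<Longrightarrow> B \<in> upper_triangular_mats n \<Longrightarrow> A + B \<in> upper_triangular_mats n"
  by (auto simp: upper_triangular_mats_iff)

lemma upper_triangular_mats_minus:
  "A \<in> upper_triangular_mats n \<Longrightarrow> B \<in> upper_triangular_mats n \<Longrightarrow> A - B \<in> upper_triangular_mats n"
  by (auto simp: upper_triangular_mats_iff)

lemma upper_triangular_mats_smult:
  "A \<in> upper_triangular_mats n \<Longrightarrow> c \<cdot>\<^sub>m A \<in> upper_triangular_mats n"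
  by (auto simp: upper_triangular_mats_iff)

lemma upper_triangular_mats_mult:
  assumes A: "A \<in> upper_triangular_mats n" and B: "B \<in> upper_triangular_mats n"
  shows "A * B \<in> upper_triangular_mats n"
proof -
  have "(A * B) $$ (p, q) = 0" if "q < p" "p < n" for p q
  proof -
    \<comment> \<open>Either \<open>k < p\<close>, which kills the left factor, or
      \<open>q < p \<le> k\<close>, which kills the right one.\<close>
    have "A $$ (p, k) * B $$ (k, q) = 0" if "k < n" for k
      using A B \<open>q < p\<close> \<open>p < n\<close> that
      by (cases "k < p") (auto simp: upper_triangular_mats_iff)
    then show ?thesis
      using that A B by (subst mult_mat_index[of _ n]) (auto simp: upper_triangular_mats_iff)
  qed
  then show ?thesis using A B by (auto simp: upper_triangular_mats_iff)
qed

text \<open>Supplies both the linearity needed to compare \<open>D\<close> with a commutator on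
  matrix units and the product rule that \<open>D\<close> then inherits.\<close>

lemma commutator_derivation_on:
  assumes A: "A \<in> upper_triangular_mats n"
  shows "derivation_on (upper_triangular_mats n) (\<lambda>X. A * X - X * A)"
proof -
  have cA: "A \<in> carrier_mat n n"
    using A by (rule upper_triangular_mats_carrier)
  have "A * (X + Y) - (X + Y) * A = (A * X - X * A) + (A * Y - Y * A)"
    if "X \<in> carrier_mat n n" "Y \<in> carrier_mat n n" for X Y
    unfolding mult_add_distrib_mat[OF cA that] add_mult_distrib_mat[OF that cA]
    using cA that by (intro eq_matI) (auto simp: algebra_simps)
  moreover have "A * (c \<cdot>\<^sub>m X) - c \<cdot>\<^sub>m X * A = c \<cdot>\<^sub>m (A * X - X * A)"
    if X: "X \<in> carrier_mat n n" for c X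
    unfolding mult_smult_distrib[OF cA X] mult_smult_assoc_mat[OF X cA]
    using cA X by (intro eq_matI) (auto simp: algebra_simps)
  moreover have "A * (X * Y) - X * Y * A = (A * X - X * A) * Y + X * (A * Y - Y * A)"
    if X: "X \<in> carrier_mat n n" and Y: "Y \<in> carrier_mat n n" for X Y
  proof -
    have "(A * X - X * A) * Y = A * (X * Y) - X * (A * Y)"
      using cA X Y by (simp add: minus_mult_distrib_mat[where nr = n and n = n and nc = n] assoc_mult_mat[of _ n n])
    moreover have "X * (A * Y - Y * A) = X * (A * Y) - X * Y * A"
      using cA X Y by (simp add: mult_minus_distrib_mat[where nr = n and n = n and nc = n] assoc_mult_mat[of _ n n])
    \<comment> \<open>Telescoping through the common middle term \<open>X * (A * Y)\<close>.\<close>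
    moreover have "A * (X * Y) - X * Y * A =
        (A * (X * Y) - X * (A * Y)) + (X * (A * Y) - X * Y * A)"
      using cA X Y by (intro eq_matI) auto
    ultimately show ?thesis by simp
  qed
  ultimately show ?thesis
    using A unfolding derivation_on_def mat_linear_on_def
    by (simp add: upper_triangular_mats_minus upper_triangular_mats_mult
        upper_triangular_mats_carrier)
qed

text \<open>The units \<open>matrix_unit n i j\<close> with \<open>i \<le> j\<close> span the
  algebra. Induction over finite sets of positions replaces an expansion of \<open>A\<close> as a
  sum of matrices.\<close>

lemma mat_linear_on_eqI:
  assumes F: "mat_linear_on (upper_triangular_mats n) F"
    and G: "mat_linear_on (upper_triangular_mats n) G"
    and eq: "\<And>i j. i \<le> j \<Longrightarrow> j < n \<Longrightarrow> F (matrix_unit n i j) = G (matrix_unit n i j)"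
    and A: "A \<in> upper_triangular_mats n"
  shows "F A = G A"
proof -
  \<comment> \<open>\<open>R S\<close> keeps the entries of \<open>A\<close> at the positions in
    \<open>S\<close> and clears the others; adding one position to \<open>S\<close> adds one
    multiple of a matrix unit.\<close>
  define R where "R S = mat n n (\<lambda>x. if x \<in> S then A $$ x else 0)" for S
  have R: "R S \<in> upper_triangular_mats n" for S
    using A by (auto simp: upper_triangular_mats_iff R_def)
  have "F (R S) = G (R S)" if "finite S" "S \<subseteq> {(i, j). i \<le> j \<and> j < n}" for S
    using that
  proof (induction S)
    case empty
    \<comment> \<open>Writing the zero matrix as a scalar multiple of itself lets homogeneity
      evaluate both maps on it.\<close>
    have "R {} = 0 \<cdot>\<^sub>m R {}"
      by (intro eq_matI) (auto simp: R_def)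
    moreover have "F (0 \<cdot>\<^sub>m R {}) = 0 \<cdot>\<^sub>m F (R {})" "G (0 \<cdot>\<^sub>m R {}) = 0 \<cdot>\<^sub>m G (R {})"
      using F G R unfolding mat_linear_on_def by blast+
    moreover have "0 \<cdot>\<^sub>m F (R {}) = 0 \<cdot>\<^sub>m G (R {})"
    proof -
      have "F (R {}) \<in> carrier_mat n n" "G (R {}) \<in> carrier_mat n n"
        using F G R upper_triangular_mats_carrier unfolding mat_linear_on_def by blast+
      then show ?thesis by (intro eq_matI) auto
    qed
    ultimately show ?case by simp
  next
    case (insert x S)
    obtain i j where x: "x = (i, j)" "i \<le> j" "j < n"
      using insert.prems by auto
    let ?c = "A $$ (i, j)"
    have E: "matrix_unit n i j \<in> upper_triangular_mats n"
      using x matrix_unit_upper_triangular by blast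
    have "R (insert x S) = ?c \<cdot>\<^sub>m matrix_unit n i j + R S"
      using insert.hyps x by (intro eq_matI) (auto simp: R_def matrix_unit_def)
    moreover have "F (?c \<cdot>\<^sub>m matrix_unit n i j + R S) = ?c \<cdot>\<^sub>m F (matrix_unit n i j) + F (R S)"
      "G (?c \<cdot>\<^sub>m matrix_unit n i j + R S) = ?c \<cdot>\<^sub>m G (matrix_unit n i j) + G (R S)"
      using F G R E upper_triangular_mats_smult unfolding mat_linear_on_def by metis+
    ultimately show ?case using insert eq x by simp
  qed
  moreover have "A = R {(i, j). i \<le> j \<and> j < n}"
    using A by (intro eq_matI) (auto simp: upper_triangular_mats_iff R_def)
  moreover have "finite {(i, j). i \<le> j \<and> j < n}"
    by (rule finite_subset[of _ "{..<n} \<times> {..<n}"]) auto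
  ultimately show ?thesis by (metis subset_refl)
qed

section \<open>The Jordan identity, polarised and read at matrix units\<close>

lemma jordan_derivation_on_polarised:
  assumes D: "jordan_derivation_on (upper_triangular_mats n) D"
    and a: "a \<in> upper_triangular_mats n" and b: "b \<in> upper_triangular_mats n"
  shows "D (a * b + b * a) = D a * b + a * D b + (D b * a + b * D a)"
proof -
  let ?T = "upper_triangular_mats n :: 'a mat set"
  have lin: "mat_linear_on ?T D"
    and sq: "\<And>x. x \<in> ?T \<Longrightarrow> D (x * x) = D x * x + x * D x"
    using D unfolding jordan_derivation_on_def by auto
  have add: "D (x + y) = D x + D y" if "x \<in> ?T" "y \<in> ?T" for x y
    using lin that unfolding mat_linear_on_def by blast
  have DT: "D x \<in> ?T" if "x \<in> ?T" for x
    using lin that unfolding mat_linear_on_def by blast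
  note [simp] = upper_triangular_mats_carrier[OF a] upper_triangular_mats_carrier[OF b]
    upper_triangular_mats_carrier[OF DT[OF a]] upper_triangular_mats_carrier[OF DT[OF b]]
  have abT: "a * a \<in> ?T" "b * b \<in> ?T" "a * b + b * a \<in> ?T" "a + b \<in> ?T"
    using a b by (auto intro: upper_triangular_mats_mult upper_triangular_mats_add)
  have cD: "D (a * b + b * a) \<in> carrier_mat n n"
    using DT abT upper_triangular_mats_carrier by blast
  \<comment> \<open>Passing to entries moves the regrouping and cancellation of summands into the
    ring \<open>'a\<close>.\<close>
  have entry: "((x + y) * (z + w)) $$ (p, q) =
      (x * z) $$ (p, q) + (x * w) $$ (p, q) + ((y * z) $$ (p, q) + (y * w) $$ (p, q))"
    if "x \<in> carrier_mat n n" "y \<in> carrier_mat n n" "z \<in> carrier_mat n n" "w \<in> carrier_mat n n"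
      "p < n" "q < n" for x y z w :: "'a mat" and p q
    using that by (simp add: mult_mat_index[where n = n] distrib_left distrib_right sum.distrib add_ac
        del: index_mult_mat(1))
  have "((a + b) * (a + b)) $$ (p, q) = ((a * a + b * b) + (a * b + b * a)) $$ (p, q)"
    if "p < n" "q < n" for p q
    using that by (simp add: entry carrier_matD[of _ n n] del: index_mult_mat(1))
  then have "(a + b) * (a + b) = (a * a + b * b) + (a * b + b * a)"
    by (intro eq_matI) (auto simp: carrier_matD[of _ n n] simp del: index_mult_mat(1) index_add_mat(1))
  \<comment> \<open>The image of the square of \<open>a + b\<close> is computed twice: by additivity
    after expanding, and by the Jordan identity at \<open>a + b\<close>. The contributions of
    \<open>a * a\<close> and \<open>b * b\<close> cancel.\<close>
  then have "D ((a + b) * (a + b)) = (D a * a + a * D a) + (D b * b + b * D b) + D (a * b + b * a)"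
    using abT by (simp add: add upper_triangular_mats_add sq a b)
  moreover have "D ((a + b) * (a + b)) = (D a + D b) * (a + b) + (a + b) * (D a + D b)"
    using abT(4) by (simp add: sq add a b)
  ultimately have eq: "(D a * a + a * D a) + (D b * b + b * D b) + D (a * b + b * a) =
      (D a + D b) * (a + b) + (a + b) * (D a + D b)"
    by (rule subst)
  have "D (a * b + b * a) $$ (p, q) = (D a * b + a * D b + (D b * a + b * D a)) $$ (p, q)"
    if pq: "p < n" "q < n" for p q
  proof -
    have "((D a * a + a * D a) + (D b * b + b * D b) + D (a * b + b * a)) $$ (p, q) =
        ((D a + D b) * (a + b) + (a + b) * (D a + D b)) $$ (p, q)"
      unfolding eq ..
    then show ?thesis
      using pq cD by (simp add: entry carrier_matD[of _ n n] del: index_mult_mat(1))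
  qed
  then show ?thesis
    using cD by (intro eq_matI) (simp_all add: carrier_matD[of _ n n] del: index_mult_mat(1))
qed

text \<open>Each of the four products with a matrix unit selects a single entry of an image under
  \<open>D\<close>. The relations between images of different units are all instances of this
  formula.\<close>

lemma jordan_derivation_on_matrix_unit_index:
  assumes D: "jordan_derivation_on (upper_triangular_mats n) D"
    and ij: "i \<le> j" "j < n" and kl: "k \<le> l" "l < n" and pq: "p < n" "q < n"
  shows "D (matrix_unit n i j * matrix_unit n k l + matrix_unit n k l * matrix_unit n i j) $$ (p, q) =
      (if q = l then D (matrix_unit n i j) $$ (p, k) else 0)
      + (if p = i then D (matrix_unit n k l) $$ (j, q) else 0)
      + (if q = j then D (matrix_unit n k l) $$ (p, i) else 0)
      + (if p = k then D (matrix_unit n i j) $$ (l, q) else 0)"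
proof -
  have "D (matrix_unit n i j) \<in> carrier_mat n n" "D (matrix_unit n k l) \<in> carrier_mat n n"
    using D ij kl matrix_unit_upper_triangular upper_triangular_mats_carrier
    unfolding jordan_derivation_on_def mat_linear_on_def by blast+
  then show ?thesis
    using ij kl pq
    by (subst jordan_derivation_on_polarised[OF D matrix_unit_upper_triangular matrix_unit_upper_triangular])
      (auto simp: mult_matrix_unit_index matrix_unit_mult_index carrier_matD[of _ n n]
        simp del: index_mult_mat(1))
qed

text \<open>This comes from the unpolarised identity at an idempotent. Polarising with both
  arguments equal would give only twice the relation, which is too weak when 2 is a zero
  divisor.\<close>

lemma jordan_derivation_on_idempotent_index:
  assumes D: "jordan_derivation_on (upper_triangular_mats n) D" and "i < n" "p < n" "q < n"
  shows "D (matrix_unit n i i) $$ (p, q) =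
      (if q = i then D (matrix_unit n i i) $$ (p, q) else 0)
      + (if p = i then D (matrix_unit n i i) $$ (p, q) else 0)"
proof -
  let ?E = "matrix_unit n i i :: 'a mat"
  have T: "?E \<in> upper_triangular_mats n"
    by (rule matrix_unit_upper_triangular) simp
  have "?E * ?E = ?E"
    using assms by (intro eq_matI)
      (auto simp: mult_matrix_unit_index carrier_matD[of _ n n] simp del: index_mult_mat(1))
  moreover have "D (?E * ?E) = D ?E * ?E + ?E * D ?E" "D ?E \<in> carrier_mat n n"
    using D T upper_triangular_mats_carrier
    unfolding jordan_derivation_on_def mat_linear_on_def by blast+
  ultimately have "D ?E $$ (p, q) = (D ?E * ?E + ?E * D ?E) $$ (p, q)" "D ?E \<in> carrier_mat n n"
    by auto
  then show ?thesis
    using assms by (auto simp: mult_matrix_unit_index matrix_unit_mult_index carrier_matD[of _ n n]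
        simp del: index_mult_mat(1))
qed

text \<open>Since \<open>i < k\<close>, the product in the reverse order vanishes. The cases
  \<open>j = i\<close> and \<open>j = k\<close> express a unit through a diagonal
  idempotent.\<close>

lemma matrix_unit_jordan_product:
  assumes "i \<le> j" "j \<le> k" "i < k" "k < n"
  shows "matrix_unit n i j * matrix_unit n j k + matrix_unit n j k * matrix_unit n i j =
    (matrix_unit n i k :: 'c :: {comm_ring, comm_monoid_mult} mat)"
  using assms by (intro eq_matI)
    (auto simp: mult_matrix_unit_index carrier_matD[of _ n n] simp del: index_mult_mat(1))

text \<open>Zero is written as a scalar multiple so that homogeneity of \<open>D\<close> applies to
  it directly.\<close>

lemma matrix_unit_orthogonal:
  assumes "i \<noteq> j" "i < n" "j < n"
  shows "matrix_unit n i i * matrix_unit n j j + matrix_unit n j j * matrix_unit n i i =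
    (0 \<cdot>\<^sub>m matrix_unit n i i :: 'c :: {comm_ring, comm_monoid_mult} mat)"
  using assms by (intro eq_matI)
    (auto simp: mult_matrix_unit_index carrier_matD[of _ n n] simp del: index_mult_mat(1))

theorem corollary2p2:
  fixes D :: "'c :: {comm_ring, comm_monoid_mult} mat \<Rightarrow> 'c mat"
    and n :: nat
  assumes "n \<ge> 2"
    and "jordan_derivation_on (upper_triangular_mats n) D"
  shows "inner_derivation_on (upper_triangular_mats n) D"
proof -
  let ?T = "upper_triangular_mats n :: 'c mat set"
  let ?E = "matrix_unit n :: nat \<Rightarrow> nat \<Rightarrow> 'c mat"
  note J = assms(2)
  have lin: "mat_linear_on ?T D"
    using J by (simp add: jordan_derivation_on_def)
  have DET: "D (?E i j) \<in> ?T" if "i \<le> j" for i j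
    using lin matrix_unit_upper_triangular[OF that] unfolding mat_linear_on_def by blast
  have DEc: "D (?E i j) \<in> carrier_mat n n" if "i \<le> j" for i j
    using DET[OF that] by (rule upper_triangular_mats_carrier)
  have low: "D (?E i j) $$ (p, q) = 0" if "i \<le> j" "q < p" "p < n" for i j p q
    using DET[OF that(1)] that by (simp add: upper_triangular_mats_iff)
  \<comment> \<open>At \<open>(i, i)\<close> the idempotent relation reads \<open>d = d + d\<close>;
    off row and column \<open>i\<close> both its summands are absent.\<close>
  have idem0: "D (?E i i) $$ (p, q) = 0" if "i < n" "p < n" "q < n" "p = i \<longleftrightarrow> q = i" for i p q
    using jordan_derivation_on_idempotent_index[OF J that(1-3)] that(4) by (cases "p = i") auto
  \<comment> \<open>This is entry \<open>(i, j)\<close> of the polarised identity for the orthogonal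
    idempotents \<open>E i i\<close> and \<open>E j j\<close>.\<close>
  have anti: "D (?E i i) $$ (i, j) = - D (?E j j) $$ (i, j)" if "i \<noteq> j" "i < n" "j < n" for i j
  proof -
    have "D (0 \<cdot>\<^sub>m ?E i i) = 0 \<cdot>\<^sub>m D (?E i i)"
      using lin matrix_unit_upper_triangular[of i i n] unfolding mat_linear_on_def by blast
    then have "D (0 \<cdot>\<^sub>m ?E i i) $$ (i, j) = 0"
      using DEc[of i i] that by (simp add: carrier_matD[of _ n n])
    then show ?thesis
      using jordan_derivation_on_matrix_unit_index[OF J, of i i j j i j] that
      by (simp add: matrix_unit_orthogonal eq_neg_iff_add_eq_0)
  qed
  \<comment> \<open>If \<open>D\<close> is the commutator with \<open>a\<close>, then entry
    \<open>(p, q)\<close> of \<open>D (E q q)\<close> is \<open>a $$ (p, q)\<close> for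
    \<open>p < q\<close>, and entry \<open>(0, p)\<close> of \<open>D (E 0 p)\<close> is
    \<open>a $$ (0, 0) - a $$ (p, p)\<close>. The diagonal is normalised by
    \<open>a $$ (0, 0) = 0\<close>, which \<open>idem0\<close> confirms.\<close>
  define a where "a = mat n n (\<lambda>(p, q). if p = q then - D (?E 0 p) $$ (0, p)
    else if p < q then D (?E q q) $$ (p, q) else 0)"
  have aT: "a \<in> ?T" and ac: "a \<in> carrier_mat n n"
    by (auto simp: a_def upper_triangular_mats_iff)
  have comm: "(a * ?E i j - ?E i j * a) $$ (p, q) =
      (if q = j then a $$ (p, i) else 0) - (if p = i then a $$ (j, q) else 0)"
    if "i \<le> j" "j < n" "p < n" "q < n" for i j p q
    using that ac by (auto simp: mult_matrix_unit_index matrix_unit_mult_index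
        carrier_matD[of _ n n] simp del: index_mult_mat(1))
  have diag: "D (?E i i) $$ (p, q) = (a * ?E i i - ?E i i * a) $$ (p, q)"
    if "i < n" "p < n" "q < n" for i p q
  proof (cases "p < q")
    \<comment> \<open>Column \<open>i\<close> agrees by the definition of \<open>a\<close>, row
      \<open>i\<close> by \<open>anti\<close>, and the other entries vanish by
      \<open>idem0\<close>.\<close>
    case True
    then show ?thesis
      using that idem0[of i p q] anti[of i q] by (auto simp: comm) (auto simp: a_def)
  next
    case False
    then show ?thesis
      using that idem0[of i p q] low[of i i q p] by (auto simp: comm) (auto simp: a_def)
  qed
  have offdiag: "D (?E i j) $$ (p, q) = (a * ?E i j - ?E i j * a) $$ (p, q)"
    if ij: "i < j" "j < n" and pq: "p < n" "q < n" for i j p q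
  proof -
    \<comment> \<open>\<open>left\<close> and \<open>right\<close> write \<open>E i j\<close> as its
      Jordan product with \<open>E i i\<close> and \<open>E j j\<close>. The first settles the
      entries with \<open>p \<noteq> i\<close> and \<open>q \<noteq> i\<close>, the second those
      with \<open>p \<noteq> j\<close> and \<open>q \<noteq> j\<close>. Only \<open>(i, j)\<close>
      and \<open>(j, i)\<close> remain.\<close>
    have left: "D (?E i j) $$ (p, q) =
      (if q = j then D (?E i i) $$ (p, i) else 0)
      + (if p = i then D (?E i j) $$ (i, q) else 0)
      + (if q = i then D (?E i j) $$ (p, i) else 0)
      + (if p = i then D (?E i i) $$ (j, q) else 0)"
      using jordan_derivation_on_matrix_unit_index[OF J, of i i i j p q] ij pq
      by (simp only: matrix_unit_jordan_product[of i i j n] simp_thms order_refl less_imp_le)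
    have right: "D (?E i j) $$ (p, q) =
      (if q = j then D (?E i j) $$ (p, j) else 0)
      + (if p = i then D (?E j j) $$ (j, q) else 0)
      + (if q = j then D (?E j j) $$ (p, i) else 0)
      + (if p = j then D (?E i j) $$ (j, q) else 0)"
      using jordan_derivation_on_matrix_unit_index[OF J, of i j j j p q] ij pq
      by (simp only: matrix_unit_jordan_product[of i j j n] simp_thms order_refl less_imp_le)
    have entry: "D (?E i j) $$ (i, j) = a $$ (i, i) - a $$ (j, j)"
    \<comment> \<open>For \<open>i = 0\<close> this is the definition of \<open>a $$ (j, j)\<close>,
      because \<open>a $$ (0, 0)\<close> vanishes by \<open>idem0\<close>.\<close>
    proof (cases "i = 0")
      case True
      then show ?thesis
        using ij idem0[of 0 0 0] by (simp add: a_def)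
    next
      case False
      then show ?thesis
        using jordan_derivation_on_matrix_unit_index[OF J, of 0 i i j 0 j] ij
        by (simp add: matrix_unit_jordan_product a_def)
    qed
    consider "p = i" "q = j" | "p \<noteq> i" "q = j" | "p = i" "q \<noteq> j" | "p = j" "q = i"
      | "p \<noteq> i" "p \<noteq> j" "q = i" | "p \<noteq> i" "q \<noteq> i" "q \<noteq> j"
      by blast
    then show ?thesis
    proof cases
      case 1
      then show ?thesis using ij entry by (simp only: comm less_imp_le order.strict_trans) simp
    next
      case 2
      have "D (?E i j) $$ (p, q) = D (?E i i) $$ (p, i)"
        using left 2 ij by simp
      also have "\<dots> = a $$ (p, i)"
        unfolding diag[OF order.strict_trans[OF ij] pq(1) order.strict_trans[OF ij]]
        using 2 ij pq by (simp only: comm order_refl) simp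
      finally show ?thesis
        using 2 ij pq by (simp only: comm less_imp_le) simp
    next
      case 3
      have "D (?E i j) $$ (p, q) = D (?E j j) $$ (j, q)"
        using right 3 ij by simp
      also have "\<dots> = - a $$ (j, q)"
        unfolding diag[OF ij(2) ij(2) pq(2)]
        using 3 ij pq by (simp only: comm order_refl) simp
      finally show ?thesis
        using 3 ij pq by (simp only: comm less_imp_le) simp
    next
      case 4
      \<comment> \<open>At \<open>(j, i)\<close> both \<open>left\<close> and \<open>right\<close>
        are tautologies; the entry vanishes because it lies below the diagonal of an upper
        triangular image.\<close>
      have "D (?E i j) $$ (p, q) = 0"
        using 4 ij low[of i j i j] by simp
      then show ?thesis
        using 4 ij pq by (simp only: comm less_imp_le) simp
    next
      case 5
      have "D (?E i j) $$ (p, q) = 0"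
        using right 5 ij by simp
      then show ?thesis
        using 5 ij pq by (simp only: comm less_imp_le) simp
    next
      case 6
      have "D (?E i j) $$ (p, q) = 0"
        using left 6 by simp
      then show ?thesis
        using 6 ij pq by (simp only: comm less_imp_le) simp
    qed
  qed
  have E: "D (?E i j) = a * ?E i j - ?E i j * a" if ij: "i \<le> j" "j < n" for i j
  proof -
    have "D (?E i j) $$ (p, q) = (a * ?E i j - ?E i j * a) $$ (p, q)" if "p < n" "q < n" for p q
      using diag[of i p q] offdiag[of i j p q] ij that by (cases "i = j") auto
    moreover have "a * ?E i j - ?E i j * a \<in> carrier_mat n n"
      using ac by (intro minus_carrier_mat mult_carrier_mat[where n = n]) simp_all
    ultimately show ?thesis
      using carrier_mat_eqI[OF DEc[OF ij(1)]] by blast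
  qed
  have der: "derivation_on ?T (\<lambda>X. a * X - X * a)"
    using aT by (rule commutator_derivation_on)
  have DX: "D X = a * X - X * a" if "X \<in> ?T" for X
    using mat_linear_on_eqI[OF lin _ E that] der by (simp add: derivation_on_def)
  \<comment> \<open>\<open>D\<close> and the commutator agree on \<open>?T\<close>, which is closed
    under products, so the product rule carries over.\<close>
  have "derivation_on ?T D"
    using der lin by (simp add: derivation_on_def DX upper_triangular_mats_mult)
  then show ?thesis
    using aT DX unfolding inner_derivation_on_def by blast
qed

end
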